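(* Let $(X_n)_{n\in\mathbb{N}}$ be a sequence of centered, real-valued, square integrable random variables on the same probability space $(\Omega,\mathcal{F},\mathbb{P})$. Suppose there exist $\gamma>0$ and $K>0$ such that for all $(m,n)\in\mathbb{N}^2$, \[ \mathbb{E}[X_mX_n]\le\frac{K}{(1+|m-n|)^{\gamma}}\ . \] Let $\beta$ be a real number in the interval $\left(\frac{1}{2},1\right)$ if $\gamma\ge 1$, or in the interval $\left(1-\frac{\gamma}{2},1\right)$ if $0<\gamma<1$. For $N\in\mathbb{N}$ let $A_N=\frac{X_1+\cdots+X_N}{N}$. Then, with probability one, \[ |A_N|=O\left(\frac{\log N}{N^{1-\beta}}\right)\quad\text{as } N\to\infty . \]
   Context: $\mathbb{N}=\{1,2,3,\ldots\}$. Centered means $\mathbb{E}X_n=0$ for all $n$. The conclusion means: for almost every $\omega\in\Omega$ there exist a constant $C(\omega)>0$ and $N_0(\omega)\in\mathbb{N}$ such that $|A_N(\omega)|\le C(\omega)\,\frac{\log N}{N^{1-\beta}}$ for all $N\ge N_0(\omega)$. Only the upper bound on $\mathbb{E}[X_mX_n]$ is assumed (no absolute value), including the case $m=n$. *)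

theory Defs
  imports "HOL-Probability.Probability" "HOL-Library.Landau_Symbols"
begin

(* Sequences are indexed from 1; the value X 0 is never used. *)
definition running_average :: "(nat \<Rightarrow> 'a \<Rightarrow> real) \<Rightarrow> nat \<Rightarrow> 'a \<Rightarrow> real" where
  "running_average X N \<omega> = (\<Sum>n=1..N. X n \<omega>) / real N"

end

(* Only dyadic block sums need control. For S N = X 1 + ... + X N put
   D i k = S ((k+1) 2^i) - S (k 2^i). The covariance bound gives E (D i k)^2 <= C 2^(i (2 - g))
   for some g < 1 with 2 - g < 2 b, so the sum of (D i k)^2 / ((k+1) 2^i)^(2 b) over all i and k
   has finite expectation. Hence almost surely |D i k| <= c ((k+1) 2^i)^b for all i and k.
   The binary expansion of N writes S N as a sum of at most log2 N + 1 such blocks, all lying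
   below N, so |S N| <= c (log2 N + 1) N^b. *)
theory Submission
  imports Defs
begin

section \<open>Second moments of block sums\<close>

text \<open>Comparison with the integral of \<open>x powr (- g)\<close> over the interval from 0 to
  L, which is finite because g < 1. Each new summand is at most the increment of the antiderivative,
  so the induction telescopes.\<close>

lemma sum_inverse_powr_le:
  fixes g :: real
  assumes "0 \<le> g" "g < 1"
  shows "(\<Sum>d<L. 1 / (1 + real d) powr g) \<le> real L powr (1 - g) / (1 - g)"
proof (induction L)
  case 0
  then show ?case by simp
next
  case (Suc L)
  have "1 / (1 + real L) powr g \<le> (real (Suc L) powr (1 - g) - real L powr (1 - g)) / (1 - g)"
  \<comment> \<open>The antiderivative need not be differentiable at 0, so the mean value theorem is
    kept for L > 0. For L = 0 the claim is 1 \<le> 1 / (1 - g).\<close>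
  proof (cases "L = 0")
    case True
    then show ?thesis using assms by (simp add: field_simps)
  next
    case False
    have "\<exists>z. real L < z \<and> z < real (Suc L) \<and>
      real (Suc L) powr (1 - g) - real L powr (1 - g)
        = (real (Suc L) - real L) * ((1 - g) * z powr (1 - g - 1))"
      using False by (intro MVT2 has_real_derivative_powr) auto
    then obtain z where z: "real L < z" "z < real (Suc L)"
      "real (Suc L) powr (1 - g) - real L powr (1 - g) = (1 - g) * z powr (- g)"
      by auto
    have "(1 + real L) powr (- g) \<le> z powr (- g)"
      using z False assms by (intro powr_mono2') auto
    then show ?thesis using z assms by (simp add: powr_minus_divide)
  qed
  then show ?case using Suc assms by (simp add: diff_divide_distrib)
qed

text \<open>Each distance d < L from m is attained at most once on either side of m, whence the
  factor 2. Nonnegativity of f allows the distances that are not attained to be added.\<close>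

lemma sum_abs_diff_le:
  fixes f :: "nat \<Rightarrow> real"
  assumes "\<And>d. 0 \<le> f d" and m: "m \<in> {a<..a + L}"
  shows "(\<Sum>n\<in>{a<..a + L}. f (nat \<bar>int m - int n\<bar>)) \<le> 2 * (\<Sum>d<L. f d)"
proof -
  let ?A = "{a<..a + L}"
  let ?h = "\<lambda>n. f (nat \<bar>int m - int n\<bar>)"
  have "sum ?h {n \<in> ?A. n \<le> m} = sum f ((\<lambda>n. m - n) ` {n \<in> ?A. n \<le> m})"
    by (subst sum.reindex) (auto simp: inj_on_def nat_diff_distrib intro!: sum.cong arg_cong[where f=f])
  also have "\<dots> \<le> sum f {..<L}"
    using assms by (intro sum_mono2) auto
  finally have 1: "sum ?h {n \<in> ?A. n \<le> m} \<le> sum f {..<L}" .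
  have "sum ?h {n \<in> ?A. m < n} = sum f ((\<lambda>n. n - m) ` {n \<in> ?A. m < n})"
    by (subst sum.reindex) (auto simp: inj_on_def nat_diff_distrib intro!: sum.cong arg_cong[where f=f])
  also have "\<dots> \<le> sum f {..<L}"
    using assms by (intro sum_mono2) auto
  finally have 2: "sum ?h {n \<in> ?A. m < n} \<le> sum f {..<L}" .
  have "sum ?h ?A = sum ?h ({n \<in> ?A. n \<le> m} \<union> {n \<in> ?A. m < n})"
    by (rule arg_cong[where f="sum ?h"]) auto
  also have "\<dots> = sum ?h {n \<in> ?A. n \<le> m} + sum ?h {n \<in> ?A. m < n}"
    by (rule sum.union_disjoint) auto
  finally show ?thesis using 1 2 by linarith
qed

lemma integrable_mult_square_integrable:
  fixes f g :: "'a \<Rightarrow> real"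
  assumes [measurable]: "f \<in> borel_measurable M" "g \<in> borel_measurable M"
    and "integrable M (\<lambda>x. (f x)\<^sup>2)" "integrable M (\<lambda>x. (g x)\<^sup>2)"
  shows "integrable M (\<lambda>x. f x * g x)"
proof (rule Bochner_Integration.integrable_bound)
  show "integrable M (\<lambda>x. (f x)\<^sup>2 + (g x)\<^sup>2)" using assms by simp
  have "\<bar>a * b\<bar> \<le> a\<^sup>2 + b\<^sup>2" for a b :: real
  proof -
    have "2 * \<bar>a * b\<bar> \<le> a\<^sup>2 + b\<^sup>2"
      using sum_squares_bound[of "\<bar>a\<bar>" "\<bar>b\<bar>"] by (simp add: abs_mult)
    then show ?thesis by linarith
  qed
  then show "AE x in M. norm (f x * g x) \<le> norm ((f x)\<^sup>2 + (g x)\<^sup>2)" by simp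
qed measurable

text \<open>Expanding the square gives L rows of mixed moments, each with coefficient +1, so
  one-sided bounds can be summed. A row contributes at most 2 K / (1 - g) times
  \<open>real L powr (1 - g)\<close>. The bound is uniform in the starting point a because the
  assumed bound depends only on the distance of the indices.\<close>

lemma block_second_moment_le:
  fixes X :: "nat \<Rightarrow> 'a \<Rightarrow> real"
  assumes meas: "\<And>n. n \<ge> 1 \<Longrightarrow> X n \<in> borel_measurable M"
    and sq: "\<And>n. n \<ge> 1 \<Longrightarrow> integrable M (\<lambda>\<omega>. (X n \<omega>)\<^sup>2)"
    and cov: "\<And>m n. m \<ge> 1 \<Longrightarrow> n \<ge> 1 \<Longrightarrow>
      (\<integral>\<omega>. X m \<omega> * X n \<omega> \<partial>M) \<le> K / (1 + \<bar>real m - real n\<bar>) powr g"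
    and K: "K \<ge> 0" and g: "0 \<le> g" "g < 1"
  shows "integrable M (\<lambda>\<omega>. (\<Sum>n\<in>{a<..a + L}. X n \<omega>)\<^sup>2)"
    and "(\<integral>\<omega>. (\<Sum>n\<in>{a<..a + L}. X n \<omega>)\<^sup>2 \<partial>M) \<le> 2 * K / (1 - g) * real L powr (2 - g)"
proof -
  let ?A = "{a<..a + L}"
  let ?f = "\<lambda>d. 1 / (1 + real d) powr g"
  have int: "integrable M (\<lambda>\<omega>. X m \<omega> * X n \<omega>)" if "m \<in> ?A" "n \<in> ?A" for m n
    using that by (intro integrable_mult_square_integrable meas sq) auto
  have eq: "(\<lambda>\<omega>. (\<Sum>n\<in>?A. X n \<omega>)\<^sup>2) = (\<lambda>\<omega>. \<Sum>m\<in>?A. \<Sum>n\<in>?A. X m \<omega> * X n \<omega>)"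
    by (simp add: power2_eq_square sum_product)
  show "integrable M (\<lambda>\<omega>. (\<Sum>n\<in>?A. X n \<omega>)\<^sup>2)"
    unfolding eq by (intro Bochner_Integration.integrable_sum int)
  have "(\<integral>\<omega>. (\<Sum>n\<in>?A. X n \<omega>)\<^sup>2 \<partial>M) = (\<Sum>m\<in>?A. \<Sum>n\<in>?A. \<integral>\<omega>. X m \<omega> * X n \<omega> \<partial>M)"
    unfolding eq
    by (subst Bochner_Integration.integral_sum)
      (auto intro!: Bochner_Integration.integrable_sum int Bochner_Integration.integral_sum sum.cong
        simp del: greaterThanAtMost_iff)
  also have "\<dots> \<le> (\<Sum>m\<in>?A. \<Sum>n\<in>?A. K * ?f (nat \<bar>int m - int n\<bar>))"
  proof (intro sum_mono)
    fix m n assume "m \<in> ?A" "n \<in> ?A"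
    then show "(\<integral>\<omega>. X m \<omega> * X n \<omega> \<partial>M) \<le> K * ?f (nat \<bar>int m - int n\<bar>)"
      using cov[of m n] by (simp add: of_nat_nat)
  qed
  also have "\<dots> = (\<Sum>m\<in>?A. K * (\<Sum>n\<in>?A. ?f (nat \<bar>int m - int n\<bar>)))"
    by (simp add: sum_distrib_left)
  also have "\<dots> \<le> (\<Sum>m\<in>?A. K * (2 * (real L powr (1 - g) / (1 - g))))"
  proof (intro sum_mono mult_left_mono K)
    fix m assume "m \<in> ?A"
    then have "(\<Sum>n\<in>?A. ?f (nat \<bar>int m - int n\<bar>)) \<le> 2 * (\<Sum>d<L. ?f d)"
      by (intro sum_abs_diff_le) auto
    then show "(\<Sum>n\<in>?A. ?f (nat \<bar>int m - int n\<bar>)) \<le> 2 * (real L powr (1 - g) / (1 - g))"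
      using sum_inverse_powr_le[OF g, of L] by linarith
  qed
  \<comment> \<open>The number L of rows is written as \<open>real L powr 1\<close> so that the
    exponents add; this also covers L = 0.\<close>
  also have "\<dots> = 2 * K / (1 - g) * (real L powr 1 * real L powr (1 - g))"
    by simp
  also have "\<dots> = 2 * K / (1 - g) * real L powr (2 - g)"
    by (subst powr_add[symmetric]) simp
  finally show "(\<integral>\<omega>. (\<Sum>n\<in>?A. X n \<omega>)\<^sup>2 \<partial>M) \<le> 2 * K / (1 - g) * real L powr (2 - g)" .
qed

section \<open>Almost sure bounds\<close>

text \<open>A nonnegative double series with finite expectation is finite almost everywhere, and its
  value bounds every term at once. The product form of the bound makes the double series of
  expectations factor into two convergent series.\<close>

lemma AE_family_bounded:
  fixes Y :: "nat \<Rightarrow> nat \<Rightarrow> 'a \<Rightarrow> real" and u v :: "nat \<Rightarrow> real"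
  assumes int: "\<And>i k. integrable M (Y i k)" and nonneg: "\<And>i k \<omega>. 0 \<le> Y i k \<omega>"
    and le: "\<And>i k. (\<integral>\<omega>. Y i k \<omega> \<partial>M) \<le> u i * v k"
    and u: "summable u" "\<And>i. 0 \<le> u i" and v: "summable v" "\<And>k. 0 \<le> v k"
  shows "AE \<omega> in M. \<exists>c\<ge>0. \<forall>i k. Y i k \<omega> \<le> c"
proof -
  have [measurable]: "Y i k \<in> borel_measurable M" for i k
    using int by auto
  let ?V = "\<lambda>\<omega>. \<Sum>i. \<Sum>k. ennreal (Y i k \<omega>)"
  have "(\<integral>\<^sup>+\<omega>. ?V \<omega> \<partial>M) = (\<Sum>i. \<Sum>k. \<integral>\<^sup>+\<omega>. ennreal (Y i k \<omega>) \<partial>M)"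
    by (simp add: nn_integral_suminf)
  also have "\<dots> = (\<Sum>i. \<Sum>k. ennreal (\<integral>\<omega>. Y i k \<omega> \<partial>M))"
    using int nonneg by (simp add: nn_integral_eq_integral)
  also have "\<dots> \<le> (\<Sum>i. \<Sum>k. ennreal (u i * v k))"
    by (intro suminf_le ennreal_leI le) auto
  also have "\<dots> = (\<Sum>i. ennreal (u i) * ennreal (suminf v))"
    using u v by (simp add: ennreal_mult suminf_ennreal2)
  also have "\<dots> = ennreal (suminf u) * ennreal (suminf v)"
    using u by (simp add: suminf_ennreal2)
  also have "\<dots> < \<infinity>"
    by (simp add: ennreal_mult_less_top)
  finally have "AE \<omega> in M. ?V \<omega> \<noteq> \<infinity>"
    by (intro nn_integral_PInf_AE) auto
  then show ?thesis
  proof eventually_elim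
    case (elim \<omega>)
    have "Y i k \<omega> \<le> enn2real (?V \<omega>)" for i k
    proof -
      have "ennreal (Y i k \<omega>) \<le> (\<Sum>k. ennreal (Y i k \<omega>))"
        using sum_le_suminf[of "\<lambda>k. ennreal (Y i k \<omega>)" "{k}"] by simp
      also have "\<dots> \<le> ?V \<omega>"
        using sum_le_suminf[of "\<lambda>i. \<Sum>k. ennreal (Y i k \<omega>)" "{i}"] by simp
      \<comment> \<open>\<open>enn2real\<close> sends infinity to 0, so the passage to real numbers
        relies on \<open>?V\<close> being finite at this point.\<close>
      finally show ?thesis
        using elim nonneg by (metis enn2real_ennreal enn2real_mono infinity_ennreal_def top.not_eq_extremum)
    qed
    then show ?case by (intro exI[of _ "enn2real (?V \<omega>)"]) auto
  qed
qed

text \<open>The scale i stays arbitrary because the induction halves m while doubling the block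
  length. An odd m first gives up its last block; the gain of 1 in log2 from halving pays for that
  block.\<close>

lemma binary_block_sum_le:
  fixes x :: "nat \<Rightarrow> real"
  assumes "0 \<le> c" "0 \<le> b"
    and block: "\<And>i k. \<bar>\<Sum>n\<in>{k * 2 ^ i<..k * 2 ^ i + 2 ^ i}. x n\<bar> \<le> c * real ((k + 1) * 2 ^ i) powr b"
    and "0 < m"
  shows "\<bar>\<Sum>n\<in>{0<..m * 2 ^ i}. x n\<bar> \<le> c * (log 2 (real m) + 1) * real (m * 2 ^ i) powr b"
  using \<open>0 < m\<close>
proof (induction m arbitrary: i rule: less_induct)
  case (less m)
  consider "m = 1" | p where "0 < p" "m = 2 * p" | p where "0 < p" "m = 2 * p + 1"
    using less.prems by (cases "m = 1"; cases "even m") (auto elim!: evenE oddE)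
  then show ?case
  proof cases
    case 1
    then show ?thesis using block[of 0 i] by simp
  next
    case 2
    have "\<bar>\<Sum>n\<in>{0<..p * 2 ^ Suc i}. x n\<bar>
        \<le> c * (log 2 (real p) + 1) * real (p * 2 ^ Suc i) powr b"
      using 2 by (intro less.IH) auto
    also have "\<dots> \<le> c * (log 2 (real m) + 1) * real (p * 2 ^ Suc i) powr b"
      using 2 assms by (intro mult_right_mono mult_left_mono) auto
    finally show ?thesis using 2 by (simp add: mult.assoc mult.left_commute)
  next
    case 3
    have pow: "p * 2 ^ Suc i = 2 * p * 2 ^ i" by simp
    have "{0<..m * 2 ^ i} = {0<..p * 2 ^ Suc i} \<union> {2 * p * 2 ^ i<..2 * p * 2 ^ i + 2 ^ i}"
      using 3 by auto
    then have "(\<Sum>n\<in>{0<..m * 2 ^ i}. x n) =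
        (\<Sum>n\<in>{0<..p * 2 ^ Suc i}. x n) + (\<Sum>n\<in>{2 * p * 2 ^ i<..2 * p * 2 ^ i + 2 ^ i}. x n)"
      by (simp only:) (rule sum.union_disjoint, auto)
    then have "\<bar>\<Sum>n\<in>{0<..m * 2 ^ i}. x n\<bar> \<le>
        \<bar>\<Sum>n\<in>{0<..p * 2 ^ Suc i}. x n\<bar> + \<bar>\<Sum>n\<in>{2 * p * 2 ^ i<..2 * p * 2 ^ i + 2 ^ i}. x n\<bar>"
      by linarith
    \<comment> \<open>The split-off block has k = 2 * p, so its right endpoint is (2 * p + 1) 2^i =
      m 2^i, the end of the whole range.\<close>
    also have "\<dots> \<le> c * (log 2 (real p) + 1) * real (p * 2 ^ Suc i) powr b
        + c * real ((2 * p + 1) * 2 ^ i) powr b"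
      using 3 by (intro add_mono less.IH block) auto
    also have "\<dots> \<le> c * (log 2 (real p) + 1) * real (m * 2 ^ i) powr b
        + c * real (m * 2 ^ i) powr b"
    proof -
      have "p * 2 ^ Suc i \<le> m * 2 ^ i"
        unfolding pow using 3 by (intro mult_right_mono) auto
      then have "real (p * 2 ^ Suc i) powr b \<le> real (m * 2 ^ i) powr b"
        using assms by (intro powr_mono2) (simp_all only: of_nat_le_iff of_nat_0_le_iff)
      then show ?thesis
        using 3 assms by (intro add_mono mult_left_mono) auto
    qed
    \<comment> \<open>The extra block turns log2 p + 1 into log2 (2 p) + 1, and 2 p \<le> m.\<close>
    also have "\<dots> = c * (log 2 (2 * real p) + 1) * real (m * 2 ^ i) powr b"
      using 3 by (simp add: log_mult algebra_simps)
    also have "\<dots> \<le> c * (log 2 (real m) + 1) * real (m * 2 ^ i) powr b"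
      using 3 assms by (intro mult_right_mono mult_left_mono) auto
    finally show ?thesis .
  qed
qed

lemma AE_partial_sum_le:
  fixes X :: "nat \<Rightarrow> 'a \<Rightarrow> real"
  assumes meas: "\<And>n. n \<ge> 1 \<Longrightarrow> X n \<in> borel_measurable M"
    and sq: "\<And>n. n \<ge> 1 \<Longrightarrow> integrable M (\<lambda>\<omega>. (X n \<omega>)\<^sup>2)"
    and cov: "\<And>m n. m \<ge> 1 \<Longrightarrow> n \<ge> 1 \<Longrightarrow>
      (\<integral>\<omega>. X m \<omega> * X n \<omega> \<partial>M) \<le> K / (1 + \<bar>real m - real n\<bar>) powr g"
    and K: "K \<ge> 0" and g: "0 \<le> g" "g < 1" and b: "2 - g < 2 * b"
  shows "AE \<omega> in M. \<exists>c\<ge>0. \<forall>N\<ge>1. \<bar>\<Sum>n=1..N. X n \<omega>\<bar> \<le> c * (log 2 (real N) + 1) * real N powr b"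
proof -
  let ?D = "\<lambda>i k \<omega>. \<Sum>n\<in>{k * 2 ^ i<..k * 2 ^ i + 2 ^ i}. X n \<omega>"
  \<comment> \<open>\<open>?t i k\<close> is the right endpoint of the block. Weighting the squared
    block sum by its power -2 b separates the two indices: \<open>?u\<close> is geometric in the
    scale, \<open>?v\<close> is a p-series in the position.\<close>
  let ?t = "\<lambda>i k. real ((k + 1) * 2 ^ i)"
  let ?u = "\<lambda>i. 2 * K / (1 - g) * (2 powr (2 - g - 2 * b)) ^ i"
  let ?v = "\<lambda>k. real (k + 1) powr (- 2 * b)"
  have t: "?t i k powr (- 2 * b) = 2 powr (- 2 * b * real i) * ?v k" for i k
  proof -
    have "?t i k = 2 powr real i * real (k + 1)"
      by (simp add: powr_realpow algebra_simps)
    then show ?thesis by (simp only: powr_mult powr_powr) (simp add: mult.commute)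
  qed
  have "AE \<omega> in M. \<exists>c\<ge>0. \<forall>i k. ?t i k powr (- 2 * b) * (?D i k \<omega>)\<^sup>2 \<le> c"
  proof (rule AE_family_bounded)
    show "integrable M (\<lambda>\<omega>. ?t i k powr (- 2 * b) * (?D i k \<omega>)\<^sup>2)" for i k
      using block_second_moment_le(1)[OF meas sq cov K g] by simp
    show "(\<integral>\<omega>. ?t i k powr (- 2 * b) * (?D i k \<omega>)\<^sup>2 \<partial>M) \<le> ?u i * ?v k" for i k
    proof -
      have "(\<integral>\<omega>. ?t i k powr (- 2 * b) * (?D i k \<omega>)\<^sup>2 \<partial>M)
          = ?t i k powr (- 2 * b) * (\<integral>\<omega>. (?D i k \<omega>)\<^sup>2 \<partial>M)"
        by simp
      also have "\<dots> \<le> ?t i k powr (- 2 * b) * (2 * K / (1 - g) * real (2 ^ i) powr (2 - g))"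
        by (intro mult_left_mono block_second_moment_le(2)[OF meas sq cov K g]) auto
      also have "real (2 ^ i) powr (2 - g) = 2 powr ((2 - g) * real i)"
        by (simp add: powr_powr mult.commute flip: powr_realpow)
      also have "?t i k powr (- 2 * b) * (2 * K / (1 - g) * 2 powr ((2 - g) * real i))
          = 2 * K / (1 - g) * (2 powr (- 2 * b * real i) * 2 powr ((2 - g) * real i)) * ?v k"
        unfolding t by simp
      also have "2 powr (- 2 * b * real i) * 2 powr ((2 - g) * real i) = (2 powr (2 - g - 2 * b)) ^ i"
        by (simp add: powr_powr algebra_simps flip: powr_add powr_realpow)
      finally show ?thesis .
    qed
    have "2 powr (2 - g - 2 * b) < 2 powr 0"
      using b by (intro powr_less_mono) auto
    then show "summable ?u"
      by (intro summable_mult summable_geometric) auto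
    \<comment> \<open>The p-series converges since 2 b > 2 - g > 1.\<close>
    have "summable (\<lambda>k. real k powr (- 2 * b))"
      using b g by (subst summable_real_powr_iff) auto
    then show "summable ?v"
      by (subst (asm) summable_Suc_iff[symmetric]) (simp add: add.commute)
  qed (use K g in auto)
  then show ?thesis
  proof eventually_elim
    case (elim \<omega>)
    then obtain c where c: "c \<ge> 0" "\<And>i k. ?t i k powr (- 2 * b) * (?D i k \<omega>)\<^sup>2 \<le> c"
      by blast
    \<comment> \<open>Removing the weight and taking square roots turns the bound c on the weighted
      squares into the constant \<open>sqrt c\<close>.\<close>
    have "\<bar>?D i k \<omega>\<bar> \<le> sqrt c * ?t i k powr b" for i k
    proof -
      have "(s powr b)\<^sup>2 * s powr (- 2 * b) = 1" if "s > 0" for s :: real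
        using that by (simp add: power2_eq_square flip: powr_add)
      from this[of "?t i k"] have "(?t i k powr b)\<^sup>2 * ?t i k powr (- 2 * b) = 1"
        by (simp only: of_nat_0_less_iff) simp
      then have "(?D i k \<omega>)\<^sup>2
          = (?t i k powr b)\<^sup>2 * (?t i k powr (- 2 * b) * (?D i k \<omega>)\<^sup>2)"
        by (simp only: mult.assoc[symmetric] mult_1)
      also have "\<dots> \<le> (?t i k powr b)\<^sup>2 * c"
        by (intro mult_left_mono c) auto
      also have "\<dots> = (sqrt c * ?t i k powr b)\<^sup>2"
        using c by (simp add: power_mult_distrib)
      finally have "\<bar>?D i k \<omega>\<bar> \<le> \<bar>sqrt c * ?t i k powr b\<bar>"
        by (simp only: abs_le_square_iff)
      also have "\<dots> = sqrt c * ?t i k powr b"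
        using c by (intro abs_of_nonneg) auto
      finally show ?thesis .
    qed
    \<comment> \<open>Scale i = 0 has blocks of length 1, so m = N reaches every partial
      sum.\<close>
    then have "\<bar>\<Sum>n\<in>{0<..N * 2 ^ 0}. X n \<omega>\<bar> \<le> sqrt c * (log 2 (real N) + 1) * real (N * 2 ^ 0) powr b"
      if "N \<ge> 1" for N
      using that b g c by (intro binary_block_sum_le) auto
    moreover have "{0<..N} = {1..N}" for N :: nat by auto
    ultimately show ?case using c by (intro exI[of _ "sqrt c"]) auto
  qed
qed

theorem theorem1:
  fixes M :: "'a measure" and X :: "nat \<Rightarrow> 'a \<Rightarrow> real" and \<gamma> K \<beta> :: real
  assumes "prob_space M"
    and "\<And>n. n \<ge> 1 \<Longrightarrow> X n \<in> borel_measurable M"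
    and "\<And>n. n \<ge> 1 \<Longrightarrow> integrable M (\<lambda>\<omega>. (X n \<omega>)\<^sup>2)"
    and "\<And>n. n \<ge> 1 \<Longrightarrow> prob_space.expectation M (X n) = 0"
    and "\<gamma> > 0" and "K > 0"
    and "\<And>m n. m \<ge> 1 \<Longrightarrow> n \<ge> 1 \<Longrightarrow>
           prob_space.expectation M (\<lambda>\<omega>. X m \<omega> * X n \<omega>) \<le> K / (1 + \<bar>real m - real n\<bar>) powr \<gamma>"
    and "\<beta> \<in> (if \<gamma> \<ge> 1 then {1/2<..<1} else {1 - \<gamma>/2<..<1})"
  shows "AE \<omega> in M.
           (\<lambda>N. \<bar>running_average X N \<omega>\<bar>) \<in> O(\<lambda>N. ln (real N) / real N powr (1 - \<beta>))"
proof -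
  \<comment> \<open>For \<open>\<gamma> \<ge> 1\<close> the exponent can be lowered to the midpoint of \<open>2 - 2 * \<beta>\<close> and \<open>1\<close>.\<close>
  obtain g where g: "0 \<le> g" "g < 1" "g \<le> \<gamma>" "2 - g < 2 * \<beta>"
  proof (cases "\<gamma> \<ge> 1")
    case True
    then show ?thesis using assms(8) by (intro that[of "3/2 - \<beta>"]) auto
  next
    case False
    then show ?thesis using assms(5,8) by (intro that[of \<gamma>]) auto
  qed
  have cov: "(\<integral>\<omega>. X m \<omega> * X n \<omega> \<partial>M) \<le> K / (1 + \<bar>real m - real n\<bar>) powr g" if "m \<ge> 1" "n \<ge> 1" for m n
  proof -
    \<comment> \<open>The base is at least 1, so lowering the exponent from \<gamma> to g weakens
      the bound.\<close>
    have "K / (1 + \<bar>real m - real n\<bar>) powr \<gamma> \<le> K / (1 + \<bar>real m - real n\<bar>) powr g"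
      using assms(6) g by (intro divide_left_mono powr_mono) auto
    then show ?thesis using assms(7)[OF that] by linarith
  qed
  have "AE \<omega> in M. \<exists>c\<ge>0. \<forall>N\<ge>1.
      \<bar>\<Sum>n=1..N. X n \<omega>\<bar> \<le> c * (log 2 (real N) + 1) * real N powr \<beta>"
    by (rule AE_partial_sum_le[OF assms(2,3) cov]) (use assms(6) g in simp_all)
  then show ?thesis
  proof eventually_elim
    case (elim \<omega>)
    then obtain c where c: "c \<ge> 0"
      "\<And>N. N \<ge> 1 \<Longrightarrow> \<bar>\<Sum>n=1..N. X n \<omega>\<bar> \<le> c * (log 2 (real N) + 1) * real N powr \<beta>"
      by blast
    \<comment> \<open>For N \<ge> 2 the summand 1 is absorbed into log2 N, giving the factor 2; the
      change of base gives 1 / ln 2. At N = 1 the right-hand side vanishes.\<close>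
    have "\<bar>running_average X N \<omega>\<bar> \<le> (2 * c / ln 2) * (ln (real N) / real N powr (1 - \<beta>))"
      if "N \<ge> 2" for N
    proof -
      have "1 \<le> log 2 (real N)" using that by simp
      then have "c * (log 2 (real N) + 1) * real N powr \<beta> \<le> c * (2 * log 2 (real N)) * real N powr \<beta>"
        using c by (intro mult_right_mono mult_left_mono) auto
      then have "\<bar>running_average X N \<omega>\<bar> \<le> c * (2 * log 2 (real N)) * real N powr \<beta> / real N"
        using c(2)[of N] that by (simp add: running_average_def divide_right_mono)
      also have "\<dots> = (2 * c / ln 2) * (ln (real N) / real N powr (1 - \<beta>))"
        using that by (simp add: log_def powr_diff)
      finally show ?thesis .
    qed
    moreover have "0 \<le> ln (real N) / real N powr (1 - \<beta>)" if "N \<ge> 2" for N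
      using that by auto
    ultimately show ?case
      by (intro bigoI[of _ "2 * c / ln 2"] eventually_sequentiallyI[of 2]) auto
  qed
qed

end
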